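(* Let $T$ be a finite metric tree, let $m\ge1$, let $r_1,\dots,r_m\ge0$, and put $S=\sum_{i=1}^m r_i$ and $M=\max_i r_i$. If $|T|\le S+M$, then $(r_1,\dots,r_m)$ is a cover of $T$.
   Context: A finite metric tree is the metric realization of a finite combinatorial tree whose edges have positive lengths (the one-point tree, of length $0$, is also allowed). $|T|$ is the total edge length, $d_T$ the path metric, and $B_T(v,s)=\{x\in T: d_T(x,v)\le s\}$. A tuple $(r_1,\dots,r_m)\in\mathbb R_{\ge0}^m$ is a cover of $T$ if there are centers $v_1,\dots,v_m\in T$ with $T\subseteq\bigcup_{i=1}^m B_T(v_i,r_i)$. *)

theory Defs
  imports "HOL-Analysis.Analysis"
begin

text \<open>
  Trees are simple graphs \<open>(V, E)\<close> whose edges are two-element sets of vertices.  The notion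
  \<open>tree\<close> of the AFP entry Graph_Theory is not suitable: there a pair of mutually inverse arcs
  already counts as a cycle.
\<close>

definition walk :: "'v set \<Rightarrow> 'v set set \<Rightarrow> 'v list \<Rightarrow> bool" where
  "walk V E p \<longleftrightarrow> p \<noteq> [] \<and> set p \<subseteq> V \<and> successively (\<lambda>u v. {u, v} \<in> E) p"

definition connected_graph :: "'v set \<Rightarrow> 'v set set \<Rightarrow> bool" where
  "connected_graph V E \<longleftrightarrow> (\<forall>u\<in>V. \<forall>v\<in>V. \<exists>p. walk V E p \<and> hd p = u \<and> last p = v)"

definition acyclic_graph :: "'v set \<Rightarrow> 'v set set \<Rightarrow> bool" where
  "acyclic_graph V E \<longleftrightarrow>
     \<not> (\<exists>p. walk V E p \<and> distinct p \<and> length p \<ge> 3 \<and> {last p, hd p} \<in> E)"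

definition finite_tree :: "'v set \<Rightarrow> 'v set set \<Rightarrow> bool" where
  "finite_tree V E \<longleftrightarrow>
     finite V \<and> V \<noteq> {} \<and> (\<forall>e\<in>E. e \<subseteq> V \<and> card e = 2) \<and> connected_graph V E \<and> acyclic_graph V E"

definition finite_metric_tree :: "'v set \<Rightarrow> 'v set set \<Rightarrow> ('v set \<Rightarrow> real) \<Rightarrow> bool" where
  "finite_metric_tree V E l \<longleftrightarrow> finite_tree V E \<and> (\<forall>e\<in>E. l e > 0)"

text \<open>
  Points of the metric realization are given by barycentric coordinates: the point at distance
  \<open>t * l {u, v}\<close> from \<open>u\<close> on the edge \<open>{u, v}\<close> is the function with value \<open>1 - t\<close> at \<open>u\<close>,
  \<open>t\<close> at \<open>v\<close> and \<open>0\<close> elsewhere.  This identifies the endpoints of edges as required.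
\<close>

definition cell :: "'v set \<Rightarrow> ('v \<Rightarrow> real) set" where
  "cell e = {x. (\<forall>v. 0 \<le> x v) \<and> (\<forall>v. v \<notin> e \<longrightarrow> x v = 0) \<and> (\<Sum>v\<in>e. x v) = 1}"

definition tree_points :: "'v set \<Rightarrow> 'v set set \<Rightarrow> ('v \<Rightarrow> real) set" where
  "tree_points V E = (\<Union>v\<in>V. cell {v}) \<union> (\<Union>e\<in>E. cell e)"

text \<open>
  On an edge \<open>e = {u, v}\<close> one has \<open>x u + x v = 1\<close>, so \<open>\<bar>x u - y u\<bar> = \<bar>x v - y v\<bar>\<close> and the value
  below is \<open>l e * \<bar>x u - y u\<bar>\<close>.
\<close>

definition edge_dist :: "('v set \<Rightarrow> real) \<Rightarrow> 'v set \<Rightarrow> ('v \<Rightarrow> real) \<Rightarrow> ('v \<Rightarrow> real) \<Rightarrow> real" where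
  "edge_dist l e x y = l e * ((\<Sum>v\<in>e. \<bar>x v - y v\<bar>) / 2)"

text \<open>
  \<open>path_length V E l x y s\<close>: some path from \<open>x\<close> to \<open>y\<close>, composed of finitely many straight
  segments each contained in an edge, has length \<open>s\<close>.
\<close>

inductive path_length ::
  "'v set \<Rightarrow> 'v set set \<Rightarrow> ('v set \<Rightarrow> real) \<Rightarrow> ('v \<Rightarrow> real) \<Rightarrow> ('v \<Rightarrow> real) \<Rightarrow> real \<Rightarrow> bool"
  for V E l where
  refl: "x \<in> tree_points V E \<Longrightarrow> path_length V E l x x 0"
| step: "path_length V E l x y s \<Longrightarrow> e \<in> E \<Longrightarrow> y \<in> cell e \<Longrightarrow> z \<in> cell e
          \<Longrightarrow> path_length V E l x z (s + edge_dist l e y z)"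

definition tree_dist ::
  "'v set \<Rightarrow> 'v set set \<Rightarrow> ('v set \<Rightarrow> real) \<Rightarrow> ('v \<Rightarrow> real) \<Rightarrow> ('v \<Rightarrow> real) \<Rightarrow> real" where
  "tree_dist V E l x y = Inf {s. path_length V E l x y s}"

definition total_length :: "'v set set \<Rightarrow> ('v set \<Rightarrow> real) \<Rightarrow> real" where
  "total_length E l = (\<Sum>e\<in>E. l e)"

definition tree_ball ::
  "'v set \<Rightarrow> 'v set set \<Rightarrow> ('v set \<Rightarrow> real) \<Rightarrow> ('v \<Rightarrow> real) \<Rightarrow> real \<Rightarrow> ('v \<Rightarrow> real) set" where
  "tree_ball V E l c s = {x \<in> tree_points V E. tree_dist V E l x c \<le> s}"

definition is_cover ::
  "'v set \<Rightarrow> 'v set set \<Rightarrow> ('v set \<Rightarrow> real) \<Rightarrow> nat \<Rightarrow> (nat \<Rightarrow> real) \<Rightarrow> bool" where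
  "is_cover V E l m r \<longleftrightarrow>
     (\<exists>c. (\<forall>i\<in>{1..m}. c i \<in> tree_points V E) \<and>
          tree_points V E \<subseteq> (\<Union>i\<in>{1..m}. tree_ball V E l (c i) (r i)))"

text \<open>The infimum is never taken over the empty set and does define a metric.\<close>

lemma edge_dist_nonneg: "l e \<ge> 0 \<Longrightarrow> edge_dist l e x y \<ge> 0"
  by (simp add: edge_dist_def sum_nonneg)

lemma edge_dist_commute: "edge_dist l e x y = edge_dist l e y x"
  by (simp add: edge_dist_def abs_minus_commute)

lemma path_length_points:
  "path_length V E l x y s \<Longrightarrow> x \<in> tree_points V E \<and> y \<in> tree_points V E"
  by (induction rule: path_length.induct) (auto simp: tree_points_def)

lemma path_length_trans:
  assumes "path_length V E l y z t" "path_length V E l x y s"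
  shows "path_length V E l x z (s + t)"
  using assms
proof (induction rule: path_length.induct)
  case (step y y' t e z)
  then show ?case using path_length.step[of V E l x y' "s + t" e z] by (simp add: add.assoc)
qed simp

lemma path_length_sym:
  assumes "path_length V E l x y s"
  shows "path_length V E l y x s"
  using assms
proof (induction rule: path_length.induct)
  case (step x y s e z)
  have "path_length V E l z y (0 + edge_dist l e z y)"
    using step by (intro path_length.step path_length.refl) (auto simp: tree_points_def)
  then show ?case using path_length_trans[OF step.IH] by (metis add.commute add_0 edge_dist_commute)
qed (rule path_length.refl)

lemma path_length_nonneg:
  assumes "\<And>e. e \<in> E \<Longrightarrow> l e \<ge> 0" "path_length V E l x y s"
  shows "s \<ge> 0"
  using assms(2) by induction (auto simp: assms(1) edge_dist_nonneg)

lemma path_length_lower: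
  assumes "finite V" "\<And>e. e \<in> E \<Longrightarrow> e \<subseteq> V \<and> k \<le> l e" "0 \<le> k" "path_length V E l x y s"
  shows "k * ((\<Sum>v\<in>V. \<bar>x v - y v\<bar>) / 2) \<le> s"
  using assms(4)
proof induction
  case (step x y s e z)
  have "(\<Sum>v\<in>V. \<bar>y v - z v\<bar>) = (\<Sum>v\<in>e. \<bar>y v - z v\<bar>)"
    using step assms by (intro sum.mono_neutral_right) (auto simp: cell_def)
  then have 1: "k * ((\<Sum>v\<in>V. \<bar>y v - z v\<bar>) / 2) \<le> edge_dist l e y z"
    using step assms by (auto simp: edge_dist_def intro!: mult_right_mono sum_nonneg)
  have "(\<Sum>v\<in>V. \<bar>x v - z v\<bar>) \<le> (\<Sum>v\<in>V. \<bar>x v - y v\<bar>) + (\<Sum>v\<in>V. \<bar>y v - z v\<bar>)"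
    by (subst sum.distrib[symmetric], rule sum_mono) linarith
  then have "k * ((\<Sum>v\<in>V. \<bar>x v - z v\<bar>) / 2)
      \<le> k * ((\<Sum>v\<in>V. \<bar>x v - y v\<bar>) / 2 + (\<Sum>v\<in>V. \<bar>y v - z v\<bar>) / 2)"
    by (intro mult_left_mono assms(3)) linarith
  then show ?case using 1 step.IH by (simp add: distrib_left)
qed simp

lemma indicator_in_cell:
  assumes "w \<in> e" "finite e"
  shows "indicator {w} \<in> cell e"
proof -
  have "(\<Sum>v\<in>e. indicator {w} v) = (\<Sum>v\<in>e. if w = v then 1 else 0 :: real)"
    by (rule sum.cong) (simp_all add: indicator_def)
  then show ?thesis using assms by (auto simp: cell_def indicator_eq_0_iff)
qed

lemma vertex_connected:
  assumes "finite_metric_tree V E l" "u \<in> V" "v \<in> V"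
  shows "\<exists>s. path_length V E l (indicator {u}) (indicator {v}) s"
proof -
  have walk: "\<exists>s. path_length V E l (indicator {hd p}) (indicator {last p}) s" if "walk V E p" for p
    using that
  proof (induction p rule: rev_induct)
    case (snoc w p)
    have w: "w \<in> V" using snoc.prems by (auto simp: walk_def)
    show ?case
    proof (cases "p = []")
      case True
      then show ?thesis using w indicator_in_cell[of w "{w}"]
        by (auto intro!: exI[of _ 0] path_length.refl simp: tree_points_def)
    next
      case False
      then have "walk V E p" and e: "{last p, w} \<in> E"
        using snoc.prems by (auto simp: walk_def successively_append_iff)
      then obtain s where "path_length V E l (indicator {hd p}) (indicator {last p}) s"
        using snoc.IH by blast
      from path_length.step[OF this e indicator_in_cell indicator_in_cell]
      show ?thesis using False by auto
    qed
  qed (simp add: walk_def)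
  obtain p where "walk V E p" "hd p = u" "last p = v"
    using assms unfolding finite_metric_tree_def finite_tree_def connected_graph_def by blast
  then show ?thesis using walk[of p] by simp
qed

lemma point_connected_vertex:
  assumes "finite_metric_tree V E l" "x \<in> tree_points V E"
  shows "\<exists>v\<in>V. \<exists>s. path_length V E l x (indicator {v}) s"
  using assms(2) unfolding tree_points_def
proof (elim UnE UN_E)
  fix v assume v: "v \<in> V" "x \<in> cell {v}"
  then have "x = indicator {v}" by (auto simp: cell_def indicator_def fun_eq_iff)
  then show ?thesis using vertex_connected[OF assms(1) v(1) v(1)] v(1) by blast
next
  fix e assume e: "e \<in> E" "x \<in> cell e"
  have "e \<subseteq> V" "card e = 2"
    using e assms(1) by (auto simp: finite_metric_tree_def finite_tree_def)
  then obtain v where v: "v \<in> e" "v \<in> V" by (auto simp: card_2_iff)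
  have "finite e" using \<open>card e = 2\<close> card.infinite by fastforce
  then have "indicator {v} \<in> cell e"
    using v by (intro indicator_in_cell)
  from path_length.step[OF path_length.refl[OF assms(2)] e this] show ?thesis using v by blast
qed

lemma path_length_ex:
  assumes "finite_metric_tree V E l" "x \<in> tree_points V E" "y \<in> tree_points V E"
  shows "\<exists>s. path_length V E l x y s"
proof -
  obtain u s where u: "u \<in> V" "path_length V E l x (indicator {u}) s"
    using point_connected_vertex[OF assms(1,2)] by blast
  obtain v t where v: "v \<in> V" "path_length V E l y (indicator {v}) t"
    using point_connected_vertex[OF assms(1,3)] by blast
  obtain a where "path_length V E l (indicator {u}) (indicator {v}) a"
    using vertex_connected[OF assms(1) u(1) v(1)] by blast
  then have "path_length V E l (indicator {u}) y (a + t)"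
    by (rule path_length_trans[OF path_length_sym[OF v(2)]])
  then show ?thesis using path_length_trans[OF _ u(2)] by blast
qed

lemma tree_dist_le:
  assumes "finite_metric_tree V E l" "path_length V E l x y s"
  shows "tree_dist V E l x y \<le> s"
proof -
  have "\<And>e. e \<in> E \<Longrightarrow> 0 \<le> l e"
    using assms(1) by (auto simp: finite_metric_tree_def intro: less_imp_le)
  then have "bdd_below {s. path_length V E l x y s}"
    by (intro bdd_belowI[of _ 0]) (blast intro: path_length_nonneg)
  then show ?thesis unfolding tree_dist_def by (intro cInf_lower) (use assms(2) in blast)
qed

lemma le_tree_dist:
  assumes "finite_metric_tree V E l" "x \<in> tree_points V E" "y \<in> tree_points V E"
    and "\<And>s. path_length V E l x y s \<Longrightarrow> b \<le> s"
  shows "b \<le> tree_dist V E l x y"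
  unfolding tree_dist_def
proof (rule cInf_greatest)
  show "{s. path_length V E l x y s} \<noteq> {}"
    using path_length_ex[OF assms(1-3)] by blast
qed (simp add: assms(4))

lemma tree_dist_nonneg:
  assumes "finite_metric_tree V E l" "x \<in> tree_points V E" "y \<in> tree_points V E"
  shows "0 \<le> tree_dist V E l x y"
proof -
  have "\<And>e. e \<in> E \<Longrightarrow> 0 \<le> l e"
    using assms(1) by (auto simp: finite_metric_tree_def intro: less_imp_le)
  then show ?thesis by (intro le_tree_dist[OF assms]) (blast intro: path_length_nonneg)
qed

lemma tree_dist_commute: "tree_dist V E l x y = tree_dist V E l y x"
  unfolding tree_dist_def by (rule arg_cong[of _ _ Inf]) (blast intro: path_length_sym)

lemma tree_dist_triangle:
  assumes T: "finite_metric_tree V E l"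
    and xyz: "x \<in> tree_points V E" "y \<in> tree_points V E" "z \<in> tree_points V E"
  shows "tree_dist V E l x z \<le> tree_dist V E l x y + tree_dist V E l y z"
proof -
  have "tree_dist V E l x z - t \<le> tree_dist V E l x y" if t: "path_length V E l y z t" for t
  proof (rule le_tree_dist[OF T xyz(1,2)])
    fix s assume "path_length V E l x y s"
    from tree_dist_le[OF T path_length_trans[OF t this]]
    show "tree_dist V E l x z - t \<le> s" by simp
  qed
  then have "tree_dist V E l x z - tree_dist V E l x y \<le> tree_dist V E l y z"
    by (intro le_tree_dist[OF T xyz(2,3)]) (simp add: algebra_simps)
  then show ?thesis by simp
qed

lemma tree_point_support:
  assumes "\<And>e. e \<in> E \<Longrightarrow> e \<subseteq> V" and "x \<in> tree_points V E"
  shows "\<forall>v. v \<notin> V \<longrightarrow> x v = 0"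
  using assms(2) unfolding tree_points_def
proof (elim UnE UN_E)
  fix u assume "u \<in> V" "x \<in> cell {u}"
  then show ?thesis by (auto simp: cell_def)
next
  fix e assume "e \<in> E" and x: "x \<in> cell e"
  then have "e \<subseteq> V" using assms(1) by simp
  then show ?thesis using x by (simp add: cell_def subset_iff) blast
qed

lemma tree_dist_eq_0_iff:
  assumes T: "finite_metric_tree V E l" and xy: "x \<in> tree_points V E" "y \<in> tree_points V E"
  shows "tree_dist V E l x y = 0 \<longleftrightarrow> x = y"
proof
  assume "x = y"
  then show "tree_dist V E l x y = 0"
    using tree_dist_le[OF T path_length.refl[OF xy(1)]] tree_dist_nonneg[OF T xy] by simp
next
  assume d: "tree_dist V E l x y = 0"
  have V: "finite V" and E: "\<And>e. e \<in> E \<Longrightarrow> e \<subseteq> V" and l: "\<And>e. e \<in> E \<Longrightarrow> l e > 0"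
    using T by (auto simp: finite_metric_tree_def finite_tree_def)
  have finE: "finite E" using V E by (auto intro: finite_subset[of E "Pow V"])
  define k where "k = Min (insert 1 (l ` E))"
  have k: "k > 0" "\<And>e. e \<in> E \<Longrightarrow> k \<le> l e" using finE l by (auto simp: k_def)
  have "k * ((\<Sum>v\<in>V. \<bar>x v - y v\<bar>) / 2) \<le> tree_dist V E l x y"
  proof (rule le_tree_dist[OF T xy])
    show "k * ((\<Sum>v\<in>V. \<bar>x v - y v\<bar>) / 2) \<le> s" if "path_length V E l x y s" for s
      by (rule path_length_lower[OF V _ _ that]) (use E k in \<open>auto intro: less_imp_le\<close>)
  qed
  then have "(\<Sum>v\<in>V. \<bar>x v - y v\<bar>) \<le> 0" using k(1) d by (simp add: mult_le_0_iff)
  then have "(\<Sum>v\<in>V. \<bar>x v - y v\<bar>) = 0" by (simp add: sum_nonneg order_antisym)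
  then have "x v = y v" if "v \<in> V" for v using V that by (simp add: sum_nonneg_eq_0_iff)
  moreover have "\<forall>v. v \<notin> V \<longrightarrow> x v = 0"
    by (rule tree_point_support[OF _ xy(1)]) (rule E)
  moreover have "\<forall>v. v \<notin> V \<longrightarrow> y v = 0"
    by (rule tree_point_support[OF _ xy(2)]) (rule E)
  ultimately show "x = y" by (metis ext)
qed

end

theory Submission
  imports Defs
begin

text \<open>
  The covering is greedy.  Root the tree.  If a radius \<open>r\<close> is given and the tree is not contained
  in the ball of radius \<open>r\<close> about the root, then some point \<open>v\<close> has the property that the part
  of the tree beyond \<open>v\<close> has height exactly \<open>r\<close> over \<open>v\<close>.  That part lies in the ball of
  radius \<open>r\<close> about \<open>v\<close>, and its length is at least \<open>r\<close>, because it contains an arc of length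
  \<open>r\<close>.  Cutting it off leaves a tree, with the same root, that is shorter by at least \<open>r\<close>
  (lemma \<open>rooted_tree_peel\<close>).

  Spend the radii in this way, keeping a largest one, \<open>M\<close>, for the end.  The tree that is left has
  length at most \<open>2 * M\<close>.  If it does not lie in the ball about its root, peel once more with
  \<open>M\<close>.  The remainder has length at most \<open>M\<close> and still contains the cut point \<open>v\<close>, and a tree
  lies within its own length of each of its points, so the ball of radius \<open>M\<close> about \<open>v\<close> covers
  both parts (lemma \<open>rooted_tree_cover\<close>).

  Cut points lie in the interior of edges, so cutting would change the underlying graph.  The
  argument is therefore carried out for tree-shaped subsets of an arbitrary metric space, which are
  generated from points by joining at the root and by prolonging the root along an arc.  A metric
  tree is such a set because it grows out of a vertex by attaching one edge after another (lemma
  \<open>rooted_tree_graft\<close> and lemma \<open>tree_points_rooted_tree\<close>).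
\<close>

section \<open>Tree-shaped sets in a metric space\<close>

context Metric_space
begin

text \<open>
  These are 1-Lipschitz curves rather than geodesics: covering asks for upper bounds on distances,
  and an upper bound on a distance that is an infimum follows from a single path.
\<close>

definition short_arc :: "real \<Rightarrow> (real \<Rightarrow> 'a) \<Rightarrow> bool" where
  "short_arc t g \<longleftrightarrow>
     0 \<le> t \<and> g ` {0..t} \<subseteq> M \<and> (\<forall>a\<in>{0..t}. \<forall>b\<in>{0..t}. d (g a) (g b) \<le> \<bar>a - b\<bar>)"

text \<open>
  In \<open>rooted_tree x A L\<close> the number \<open>L\<close> is the length of the pieces used in the construction.
  Overlapping pieces are counted repeatedly, so \<open>L\<close> only bounds the length of \<open>A\<close> from above.
\<close>

inductive rooted_tree :: "'a \<Rightarrow> 'a set \<Rightarrow> real \<Rightarrow> bool" where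
  point: "x \<in> M \<Longrightarrow> rooted_tree x {x} 0"
| join: "rooted_tree x A K \<Longrightarrow> rooted_tree x B L \<Longrightarrow> rooted_tree x (A \<union> B) (K + L)"
| stem: "short_arc t g \<Longrightarrow> rooted_tree (g t) A L \<Longrightarrow> rooted_tree (g 0) (g ` {0..t} \<union> A) (t + L)"

lemma short_arc_initial: "short_arc t g \<Longrightarrow> 0 \<le> s \<Longrightarrow> s \<le> t \<Longrightarrow> short_arc s g"
  by (auto simp: short_arc_def image_subset_iff)

lemma short_arc_in: "short_arc t g \<Longrightarrow> a \<in> {0..t} \<Longrightarrow> g a \<in> M"
  by (auto simp: short_arc_def)

lemma short_arc_dist: "short_arc t g \<Longrightarrow> a \<in> {0..t} \<Longrightarrow> b \<in> {0..t} \<Longrightarrow> d (g a) (g b) \<le> \<bar>a - b\<bar>"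
  by (auto simp: short_arc_def)

lemma short_arc_final:
  assumes "short_arc t g" "0 \<le> s" "s \<le> t"
  shows "short_arc (t - s) (\<lambda>a. g (s + a))"
proof -
  have "d (g (s + a)) (g (s + b)) \<le> \<bar>a - b\<bar>" if "a \<in> {0..t - s}" "b \<in> {0..t - s}" for a b
    using short_arc_dist[OF assms(1), of "s + a" "s + b"] that assms by simp
  moreover have "g (s + a) \<in> M" if "a \<in> {0..t - s}" for a
    using short_arc_in[OF assms(1)] that assms by simp
  ultimately show ?thesis using assms by (auto simp: short_arc_def)
qed

lemma short_arc_split:
  assumes "0 \<le> s" "s \<le> (t::real)"
  shows "g ` {0..t} = g ` {0..s} \<union> (\<lambda>a. g (s + a)) ` {0..t - s}"
proof -
  have "(+) s ` {0..t - s} = {s..t}"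
    using image_add_atLeastAtMost[of s 0 "t - s"] by simp
  then have "(\<lambda>a. g (s + a)) ` {0..t - s} = g ` {s..t}"
    by (metis image_image)
  moreover have "{0..t} = {0..s} \<union> {s..t}"
    using assms by (simp add: ivl_disj_un_two_touch)
  ultimately show ?thesis by (simp add: image_Un)
qed

lemma rooted_tree_root: "rooted_tree x A L \<Longrightarrow> x \<in> A \<and> A \<subseteq> M \<and> 0 \<le> L"
  by (induction rule: rooted_tree.induct) (auto simp: short_arc_def image_subset_iff)

lemma rooted_tree_arc:
  assumes "short_arc t g"
  shows "rooted_tree (g 0) (g ` {0..t}) t"
proof -
  have t: "t \<in> {0..t}" using assms by (simp add: short_arc_def)
  then have "rooted_tree (g 0) (g ` {0..t} \<union> {g t}) (t + 0)"
    by (intro rooted_tree.stem rooted_tree.point short_arc_in[OF assms] assms)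
  then show ?thesis using t by (simp add: insert_absorb)
qed

lemma rooted_tree_height:
  "rooted_tree x A L \<Longrightarrow> a \<in> A \<Longrightarrow> d x a \<le> L"
proof (induction arbitrary: a rule: rooted_tree.induct)
  case (join x A K B L)
  then show ?case using rooted_tree_root[OF join.hyps(1)] rooted_tree_root[OF join.hyps(2)]
    by fastforce
next
  case (stem t g A L)
  note A = rooted_tree_root[OF stem.hyps(2)]
  have t: "0 \<le> t" using stem.hyps(1) by (simp add: short_arc_def)
  show ?case
  proof (cases "a \<in> A")
    case True
    have "d (g 0) a \<le> d (g 0) (g t) + d (g t) a"
      using True A t stem.hyps(1) by (intro triangle) (auto intro: short_arc_in)
    then show ?thesis
      using stem.IH[OF True] short_arc_dist[OF stem.hyps(1), of 0 t] t by simp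
  next
    case False
    then obtain s where "s \<in> {0..t}" "a = g s" using stem.prems by blast
    then show ?thesis using short_arc_dist[OF stem.hyps(1), of 0 s] A by auto
  qed
qed simp

lemma rooted_tree_diameter:
  "rooted_tree x A L \<Longrightarrow> a \<in> A \<Longrightarrow> b \<in> A \<Longrightarrow> d a b \<le> L"
proof (induction arbitrary: a b rule: rooted_tree.induct)
  case (join x A K B L)
  note A = rooted_tree_root[OF join.hyps(1)] and B = rooted_tree_root[OF join.hyps(2)]
  have across: "d p q \<le> K + L" if "p \<in> A" "q \<in> B" for p q
  proof -
    have "d p q \<le> d p x + d x q" using that A B by (intro triangle) auto
    then show ?thesis
      using rooted_tree_height[OF join.hyps(1) that(1)] rooted_tree_height[OF join.hyps(2) that(2)]
      by (simp add: commute)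
  qed
  have inside: "p \<in> A \<Longrightarrow> q \<in> A \<Longrightarrow> d p q \<le> K + L" "p \<in> B \<Longrightarrow> q \<in> B \<Longrightarrow> d p q \<le> K + L" for p q
    using join.IH(1)[of p q] join.IH(2)[of p q] A B by auto
  show ?case
    using join.prems across[of a b] across[of b a] inside commute[of a b] by auto
next
  case (stem t g A L)
  note A = rooted_tree_root[OF stem.hyps(2)]
  have t: "0 \<le> t" using stem.hyps(1) by (simp add: short_arc_def)
  have across: "d (g s) q \<le> t + L" if "s \<in> {0..t}" "q \<in> A" for s q
  proof -
    have "d (g s) q \<le> d (g s) (g t) + d (g t) q"
      using that A t stem.hyps(1) by (intro triangle) (auto intro: short_arc_in)
    then show ?thesis
      using rooted_tree_height[OF stem.hyps(2) that(2)]
        short_arc_dist[OF stem.hyps(1) that(1), of t] that t by simp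
  qed
  have along: "d (g s) (g s') \<le> t + L" if "s \<in> {0..t}" "s' \<in> {0..t}" for s s'
    using short_arc_dist[OF stem.hyps(1) that] that A by auto
  have inside: "d p q \<le> t + L" if "p \<in> A" "q \<in> A" for p q
    using stem.IH[OF that] t by simp
  show ?case
    using stem.prems across along inside by (auto simp: commute)
qed simp

text \<open>
  The construction prolongs a tree at its root, whereas a graph is explored away from the root.
  Attaching an arc at an arbitrary point reconciles the two: if that point lies on a stem, the stem
  is cut there and both upper parts are joined.
\<close>

lemma rooted_tree_graft:
  "rooted_tree x A L \<Longrightarrow> short_arc t g \<Longrightarrow> g 0 \<in> A \<Longrightarrow> rooted_tree x (A \<union> g ` {0..t}) (L + t)"
proof (induction rule: rooted_tree.induct)
  case (point x)
  then have x: "g 0 = x" "x \<in> g ` {0..t}" by (auto simp: short_arc_def)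
  show ?case using rooted_tree_arc[OF point.prems(1)] x by (simp add: insert_absorb)
next
  case (join x A K B L)
  show ?case
  proof (cases "g 0 \<in> A")
    case True
    from rooted_tree.join[OF join.IH(1)[OF join.prems(1) True] join.hyps(2)]
    show ?thesis by (simp add: ac_simps)
  next
    case False
    then have "g 0 \<in> B" using join.prems by simp
    from rooted_tree.join[OF join.hyps(1) join.IH(2)[OF join.prems(1) this]]
    show ?thesis by (simp add: ac_simps)
  qed
next
  case (stem t' h A L)
  show ?case
  proof (cases "g 0 \<in> A")
    case True
    from rooted_tree.stem[OF stem.hyps(1) stem.IH[OF stem.prems(1) True]]
    show ?thesis by (simp add: ac_simps)
  next
    case False
    then obtain s where s: "0 \<le> s" "s \<le> t'" "g 0 = h s" using stem.prems(2) by auto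
    let ?h = "\<lambda>a. h (s + a)"
    have "rooted_tree (?h 0) (?h ` {0..t' - s} \<union> A) (t' - s + L)"
      using stem.hyps s by (intro rooted_tree.stem short_arc_final) auto
    then have old: "rooted_tree (h s) (?h ` {0..t' - s} \<union> A) (t' - s + L)" by simp
    have new: "rooted_tree (h s) (g ` {0..t}) t"
      using rooted_tree_arc[OF stem.prems(1)] unfolding s(3) .
    have tree: "rooted_tree (h 0) (h ` {0..s} \<union> ((?h ` {0..t' - s} \<union> A) \<union> g ` {0..t}))
        (s + (t' - s + L + t))"
      by (rule rooted_tree.stem[OF short_arc_initial[OF stem.hyps(1) s(1,2)]
            rooted_tree.join[OF old new]])
    have sets: "h ` {0..s} \<union> ((?h ` {0..t' - s} \<union> A) \<union> g ` {0..t})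
        = (h ` {0..t'} \<union> A) \<union> g ` {0..t}"
      unfolding short_arc_split[OF s(1,2), of h] by (simp only: Un_assoc)
    have lengths: "s + (t' - s + L + t) = t' + L + t" by simp
    from tree show ?thesis unfolding sets lengths .
  qed
qed

section \<open>Greedy covering\<close>

text \<open>
  A witness \<open>h\<close> for the height is carried along in the first alternative because it determines
  where to cut: when a stem makes the height exceed \<open>r\<close>, the cut is made on the stem at distance
  \<open>r - h\<close> from its upper end, so that the part above has height at most \<open>r\<close>.  This part has length
  \<open>L + (r - h)\<close>, which is at least \<open>r\<close> because \<open>h \<le> L\<close>.
\<close>

lemma rooted_tree_peel:
  assumes "rooted_tree x A L" "0 \<le> r"
  shows "(\<exists>h\<le>min L r. A \<subseteq> mcball x h) \<or>
    (\<exists>v A' L'. rooted_tree x A' L' \<and> v \<in> A' \<and> A \<subseteq> A' \<union> mcball v r \<and> L' \<le> L - r)"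
  using assms(1)
proof (induction rule: rooted_tree.induct)
  case (point x)
  then have "{x} \<subseteq> mcball x 0" by simp
  then show ?case using assms(2) by force
next
  case (join x A K B L)
  show ?case
  proof (cases "(\<exists>h\<le>min K r. A \<subseteq> mcball x h) \<and> (\<exists>h\<le>min L r. B \<subseteq> mcball x h)")
    case True
    then obtain h k where h: "h \<le> K" "h \<le> r" "A \<subseteq> mcball x h"
      and k: "k \<le> L" "k \<le> r" "B \<subseteq> mcball x k" by auto
    have "max h k \<le> min (K + L) r"
      using h k rooted_tree_root[OF join.hyps(1)] rooted_tree_root[OF join.hyps(2)] by auto
    moreover have "A \<union> B \<subseteq> mcball x (max h k)"
      using h(3) k(3) mcball_subset_concentric[of h "max h k" x]
        mcball_subset_concentric[of k "max h k" x] by auto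
    ultimately show ?thesis by blast
  next
    case False
    then consider
      v A' L' where "rooted_tree x A' L'" "v \<in> A'" "A \<subseteq> A' \<union> mcball v r" "L' \<le> K - r"
      | v A' L' where "rooted_tree x A' L'" "v \<in> A'" "B \<subseteq> A' \<union> mcball v r" "L' \<le> L - r"
      using join.IH by blast
    then show ?thesis
    proof cases
      case (1 v A' L')
      show ?thesis
        using rooted_tree.join[OF 1(1) join.hyps(2)] 1
        by (intro disjI2 exI[of _ v] exI[of _ "A' \<union> B"] exI[of _ "L' + L"]) auto
    next
      case (2 v A' L')
      show ?thesis
        using rooted_tree.join[OF join.hyps(1) 2(1)] 2
        by (intro disjI2 exI[of _ v] exI[of _ "A \<union> A'"] exI[of _ "K + L'"]) auto
    qed
  qed
next
  case (stem t g A L)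
  have t: "0 \<le> t" using stem.hyps by (simp add: short_arc_def)
  note A = rooted_tree_root[OF stem.hyps(2)]
  from stem.IH show ?case
  proof (elim disjE exE conjE)
    fix v A' L'
    assume *: "rooted_tree (g t) A' L'" "v \<in> A'" "A \<subseteq> A' \<union> mcball v r" "L' \<le> L - r"
    show ?thesis
      using rooted_tree.stem[OF stem.hyps(1) *(1)] *
      by (intro disjI2 exI[of _ v] exI[of _ "g ` {0..t} \<union> A'"] exI[of _ "t + L'"]) auto
  next
    fix h assume h: "h \<le> min L r" "A \<subseteq> mcball (g t) h"
    have h0: "0 \<le> h" using h A by (auto simp: subset_iff)
    \<comment> \<open>Seen from a point of the stem, the height above it grows with the distance to the upper end.\<close>
    have above: "g ` {s..t} \<union> A \<subseteq> mcball (g s) (t - s + h)" if s: "0 \<le> s" "s \<le> t" for s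
    proof
      fix a assume a: "a \<in> g ` {s..t} \<union> A"
      have gs: "g s \<in> M" "g t \<in> M" using s short_arc_in[OF stem.hyps(1)] by auto
      show "a \<in> mcball (g s) (t - s + h)"
      proof (cases "a \<in> A")
        case True
        then have "a \<in> M" "d (g t) a \<le> h" using h(2) by auto
        then show ?thesis
          using triangle[OF gs \<open>a \<in> M\<close>] short_arc_dist[OF stem.hyps(1), of s t] s gs by auto
      next
        case False
        then obtain b where b: "s \<le> b" "b \<le> t" "a = g b" using a by auto
        have "d (g s) (g b) \<le> b - s"
          using short_arc_dist[OF stem.hyps(1), of s b] b s by auto
        then show ?thesis using b s h0 gs short_arc_in[OF stem.hyps(1), of b] by auto
      qed
    qed
    show ?thesis
    proof (cases "t + h \<le> r")
      case True
      then show ?thesis using above[of 0] t h by (intro disjI1 exI[of _ "t + h"]) auto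
    next
      case False
      define s where "s = t - (r - h)"
      have s: "0 \<le> s" "s \<le> t" using False h by (auto simp: s_def)
      have "rooted_tree (g 0) (g ` {0..s}) s"
        by (rule rooted_tree_arc[OF short_arc_initial[OF stem.hyps(1) s]])
      moreover have "g ` {0..t} \<union> A \<subseteq> g ` {0..s} \<union> mcball (g s) r"
      proof -
        have "{0..t} = {0..s} \<union> {s..t}" using s by (simp add: ivl_disj_un_two_touch)
        then have "g ` {0..t} = g ` {0..s} \<union> g ` {s..t}" by (simp only: image_Un)
        then show ?thesis using above[OF s] by (auto simp: s_def)
      qed
      moreover have "s \<le> t + L - r" using h by (simp add: s_def)
      moreover have "g s \<in> g ` {0..s}" using s by simp
      ultimately show ?thesis by blast
    qed
  qed
qed

text \<open>
  One distinguished radius counts twice: it is spent last, on a tree of length at most twice that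
  radius.
\<close>

lemma rooted_tree_cover:
  assumes "finite J" "rooted_tree x A L" "j \<notin> J" "\<And>i. i \<in> insert j J \<Longrightarrow> 0 \<le> r i"
    and "L \<le> sum r J + 2 * r j"
  shows "\<exists>c. (\<forall>i\<in>insert j J. c i \<in> M) \<and> A \<subseteq> (\<Union>i\<in>insert j J. mcball (c i) (r i))"
  using assms
proof (induction J arbitrary: A L rule: finite_induct)
  case empty
  have "\<exists>v\<in>M. A \<subseteq> mcball v (r j)"
    using rooted_tree_peel[OF empty.prems(1) empty.prems(3)[OF insertI1]]
  proof (elim disjE exE conjE)
    fix h assume "h \<le> min L (r j)" "A \<subseteq> mcball x h"
    then have "A \<subseteq> mcball x (r j)" using mcball_subset_concentric[of h "r j" x] by auto
    then show ?thesis using rooted_tree_root[OF empty.prems(1)] by auto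
  next
    fix v A' L'
    assume *: "rooted_tree x A' L'" "v \<in> A'" "A \<subseteq> A' \<union> mcball v (r j)" "L' \<le> L - r j"
    have "A' \<subseteq> mcball v (r j)"
    proof
      fix a assume "a \<in> A'"
      then have "d v a \<le> L'" using rooted_tree_diameter[OF *(1,2)] by blast
      then show "a \<in> mcball v (r j)"
        using * \<open>a \<in> A'\<close> rooted_tree_root[OF *(1)] empty.prems(4) by auto
    qed
    then show ?thesis using * rooted_tree_root[OF *(1)] by (intro bexI[of _ v]) auto
  qed
  then show ?case by auto
next
  case (insert i J)
  have ri: "0 \<le> r i" using insert.prems(3) by simp
  from rooted_tree_peel[OF insert.prems(1) ri] show ?case
  proof (elim disjE exE conjE)
    fix h assume "h \<le> min L (r i)" "A \<subseteq> mcball x h"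
    then have "A \<subseteq> mcball x (r i)" using mcball_subset_concentric[of h "r i" x] by auto
    then show ?thesis
      using rooted_tree_root[OF insert.prems(1)] by (intro exI[of _ "\<lambda>_. x"]) auto
  next
    fix v A' L'
    assume *: "rooted_tree x A' L'" "v \<in> A'" "A \<subseteq> A' \<union> mcball v (r i)" "L' \<le> L - r i"
    have "L' \<le> sum r J + 2 * r j" using * insert.prems(4) insert.hyps by simp
    then obtain c where c: "\<forall>k\<in>insert j J. c k \<in> M"
      "A' \<subseteq> (\<Union>k\<in>insert j J. mcball (c k) (r k))"
      using insert.IH[OF *(1)] insert.prems by auto
    have i: "i \<notin> insert j J" using insert by auto
    let ?c = "c(i := v)"
    have "(\<Union>k\<in>insert j J. mcball (c k) (r k)) = (\<Union>k\<in>insert j J. mcball (?c k) (r k))"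
      using i by (intro SUP_cong) auto
    then have "A' \<subseteq> (\<Union>k\<in>insert j J. mcball (?c k) (r k))" using c(2) by simp
    then have "A \<subseteq> (\<Union>k\<in>insert j (insert i J). mcball (?c k) (r k))"
      using *(3) by auto
    moreover have "\<forall>k\<in>insert j (insert i J). ?c k \<in> M"
      using c(1) * rooted_tree_root[OF *(1)] by auto
    ultimately show ?thesis by blast
  qed
qed

end

section \<open>Metric trees as tree-shaped sets\<close>

text \<open>
  The absolute value matters only for arguments that are not points of the tree, where the
  infimum defining \<open>tree_dist\<close> is taken over the empty set while a metric on a carrier is required
  to be nonnegative everywhere.
\<close>

lemma Metric_space_tree:
  assumes "finite_metric_tree V E l"
  shows "Metric_space (tree_points V E) (\<lambda>x y. \<bar>tree_dist V E l x y\<bar>)"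
  using tree_dist_nonneg[OF assms] tree_dist_triangle[OF assms] tree_dist_eq_0_iff[OF assms]
  by unfold_locales (auto simp: tree_dist_commute)

lemma vertex_tree_point: "v \<in> V \<Longrightarrow> indicator {v} \<in> tree_points V E"
  using indicator_in_cell[of v "{v}"] by (auto simp: tree_points_def)

lemma cell_arc:
  assumes T: "finite_metric_tree V E l" and e: "e \<in> E" "u \<in> e"
  obtains g where
    "Metric_space.short_arc (tree_points V E) (\<lambda>x y. \<bar>tree_dist V E l x y\<bar>) (l e) g"
    "g 0 = indicator {u}" "g ` {0..l e} = cell e"
proof -
  interpret Metric_space "tree_points V E" "\<lambda>x y. \<bar>tree_dist V E l x y\<bar>"
    by (rule Metric_space_tree[OF T])
  have "card e = 2" and l: "0 < l e"
    using T e by (auto simp: finite_metric_tree_def finite_tree_def)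
  then obtain w where w: "e = {u, w}" "u \<noteq> w" using e(2) by (auto simp: card_2_iff)
  define g :: "real \<Rightarrow> 'a \<Rightarrow> real"
    where "g = (\<lambda>s v. if v = u then 1 - s / l e else if v = w then s / l e else 0)"
  have cell: "g s \<in> cell e" if "s \<in> {0..l e}" for s
    using that l w by (auto simp: g_def cell_def divide_le_eq_1)
  have points: "cell e \<subseteq> tree_points V E" using e by (auto simp: tree_points_def)
  have dist: "\<bar>tree_dist V E l (g a) (g b)\<bar> \<le> \<bar>a - b\<bar>"
    if ab: "a \<in> {0..l e}" "b \<in> {0..l e}" for a b
  proof -
    have in_cell: "g a \<in> cell e" "g b \<in> cell e" using cell ab by auto
    then have P: "g a \<in> tree_points V E" "g b \<in> tree_points V E" using points by auto
    have "tree_dist V E l (g a) (g b) \<le> 0 + edge_dist l e (g a) (g b)"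
      by (intro tree_dist_le[OF T] path_length.step path_length.refl P e in_cell)
    also have "\<dots> = l e * \<bar>a / l e - b / l e\<bar>"
      using w by (auto simp: edge_dist_def g_def)
    also have "\<dots> = \<bar>a - b\<bar>"
      using l by (simp add: abs_mult flip: diff_divide_distrib)
    finally show ?thesis using tree_dist_nonneg[OF T P] by simp
  qed
  show ?thesis
  proof
    show "short_arc (l e) g"
      using l cell points dist unfolding short_arc_def by auto
    show "g 0 = indicator {u}" by (auto simp: g_def indicator_def fun_eq_iff)
    show "g ` {0..l e} = cell e"
    proof
      show "cell e \<subseteq> g ` {0..l e}"
      proof
        fix x assume "x \<in> cell e"
        then have x: "\<And>v. 0 \<le> x v" "\<And>v. v \<notin> e \<Longrightarrow> x v = 0" "x u + x w = 1"
          using w by (auto simp: cell_def)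
        have "x = g (l e * x w)"
          using x l w by (auto simp: g_def fun_eq_iff)
        moreover have "l e * x w \<in> {0..l e}"
          using x(1)[of u] x(1)[of w] x(3) l by (auto simp: mult_le_cancel_left1)
        ultimately show "x \<in> g ` {0..l e}" by blast
      qed
    qed (use cell in auto)
  qed
qed

lemma walk_crossing:
  assumes "walk V E p" "P (hd p)" "\<not> P (last p)"
  shows "\<exists>a b. {a, b} \<in> E \<and> P a \<and> \<not> P b"
  using assms
proof (induction p)
  case (Cons a p)
  show ?case
  proof (cases p)
    case Nil
    then show ?thesis using Cons.prems by simp
  next
    case (Cons b q)
    then have "walk V E p" "{a, b} \<in> E" "hd p = b" "last (a # p) = last p"
      using Cons.prems by (auto simp: walk_def)
    then show ?thesis using Cons.IH Cons.prems by (cases "P b") auto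
  qed
qed (simp add: walk_def)

text \<open>
  A largest set of edges that can be attached to one another, starting from a vertex, contains all
  edges: if it did not, a walk to a missing edge would leave it through an edge that has one
  endpoint in the part already built, and this edge could be attached as well.
\<close>

lemma tree_points_rooted_tree:
  assumes T: "finite_metric_tree V E l"
  shows "\<exists>x A. Metric_space.rooted_tree (tree_points V E) (\<lambda>x y. \<bar>tree_dist V E l x y\<bar>) x A
    (total_length E l) \<and> tree_points V E \<subseteq> A"
proof -
  interpret Metric_space "tree_points V E" "\<lambda>x y. \<bar>tree_dist V E l x y\<bar>"
    by (rule Metric_space_tree[OF T])
  have finV: "finite V" and ne: "V \<noteq> {}" and E: "\<And>e. e \<in> E \<Longrightarrow> e \<subseteq> V \<and> card e = 2"
    and conn: "connected_graph V E"
    using T by (auto simp: finite_metric_tree_def finite_tree_def)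
  have finE: "finite E" using finV E by (auto intro: finite_subset[of E "Pow V"])
  obtain \<rho> where \<rho>: "\<rho> \<in> V" using ne by blast
  define grown where "grown F A \<longleftrightarrow>
    F \<subseteq> E \<and> rooted_tree (indicator {\<rho>}) A (sum l F) \<and> (\<Union>e\<in>F. cell e) \<subseteq> A" for F A
  have "grown {} {indicator {\<rho>}}"
    using \<rho> by (auto simp: grown_def intro: rooted_tree.point vertex_tree_point)
  then have "\<exists>A. grown {} A" ..
  moreover have "\<forall>F. (\<exists>A. grown F A) \<longrightarrow> card F < Suc (card E)"
    using finE by (auto simp: grown_def less_Suc_eq_le intro: card_mono)
  ultimately obtain F where F: "\<exists>A. grown F A"
    and F_max: "\<And>F'. \<exists>A. grown F' A \<Longrightarrow> card F' \<le> card F"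
    using ex_has_greatest_nat[of "\<lambda>F. \<exists>A. grown F A" "{}" card "Suc (card E)"] by auto
  then obtain A where A: "grown F A" by blast
  have finF: "finite F" using A finE by (auto simp: grown_def intro: finite_subset)
  have attached: "e \<in> F" if e: "e \<in> E" "u \<in> e" "indicator {u} \<in> A" for e u
  proof (rule ccontr)
    assume "e \<notin> F"
    obtain g where g: "short_arc (l e) g" "g 0 = indicator {u}" "g ` {0..l e} = cell e"
      using cell_arc[OF T e(1,2)] .
    have "rooted_tree (indicator {\<rho>}) (A \<union> cell e) (sum l F + l e)"
      using rooted_tree_graft[OF _ g(1)] A e g by (auto simp: grown_def)
    then have "grown (insert e F) (A \<union> cell e)"
      using A e finF \<open>e \<notin> F\<close> by (auto simp: grown_def add.commute)
    then have "card (insert e F) \<le> card F" using F_max by blast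
    then show False using finF \<open>e \<notin> F\<close> by simp
  qed
  have vertices: "indicator {v} \<in> A" if V: "v \<in> V" for v
  proof (rule ccontr)
    assume v: "indicator {v} \<notin> A"
    obtain p where p: "walk V E p" "hd p = \<rho>" "last p = v"
      using conn \<rho> V unfolding connected_graph_def by blast
    have "indicator {\<rho>} \<in> A" using A rooted_tree_root by (auto simp: grown_def)
    then have "\<exists>a b. {a, b} \<in> E \<and> indicator {a} \<in> A \<and> indicator {b} \<notin> A"
      by (intro walk_crossing[OF p(1), of "\<lambda>v. indicator {v} \<in> A"]) (simp_all add: p v)
    then obtain a b where ab: "{a, b} \<in> E" "indicator {a} \<in> A" "indicator {b} \<notin> A" by blast
    then have "{a, b} \<in> F" using attached by blast
    then show False using A ab indicator_in_cell[of b "{a, b}"] by (auto simp: grown_def)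
  qed
  have "e \<in> F" if e: "e \<in> E" for e
  proof -
    obtain u where "u \<in> e" "u \<in> V" using E[OF e] by (fastforce simp: card_2_iff)
    then show ?thesis using attached e vertices by blast
  qed
  then have "F = E" using A by (auto simp: grown_def)
  then have "rooted_tree (indicator {\<rho>}) A (total_length E l)" "(\<Union>e\<in>E. cell e) \<subseteq> A"
    using A by (auto simp: grown_def total_length_def)
  moreover have "cell {v} \<subseteq> A" if "v \<in> V" for v
  proof -
    have "x = indicator {v}" if "x \<in> cell {v}" for x
      using that by (auto simp: cell_def indicator_def fun_eq_iff)
    then show ?thesis using vertices[OF \<open>v \<in> V\<close>] by blast
  qed
  ultimately show ?thesis unfolding tree_points_def by blast
qed

section \<open>Covering a metric tree\<close>

theorem lemma2p10:
  fixes V :: "'v set" and E :: "'v set set" and l :: "'v set \<Rightarrow> real"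
    and m :: nat and r :: "nat \<Rightarrow> real"
  assumes "finite_metric_tree V E l"
    and "m \<ge> 1"
    and "\<And>i. i \<in> {1..m} \<Longrightarrow> r i \<ge> 0"
    and "total_length E l \<le> (\<Sum>i=1..m. r i) + Max (r ` {1..m})"
  shows "is_cover V E l m r"
proof -
  interpret Metric_space "tree_points V E" "\<lambda>x y. \<bar>tree_dist V E l x y\<bar>"
    by (rule Metric_space_tree[OF assms(1)])
  obtain x A where A: "rooted_tree x A (total_length E l)" "tree_points V E \<subseteq> A"
    using tree_points_rooted_tree[OF assms(1)] by blast
  have "Max (r ` {1..m}) \<in> r ` {1..m}" using assms(2) by (intro Max_in) auto
  then obtain j where j: "j \<in> {1..m}" "Max (r ` {1..m}) = r j" by auto
  then have I: "insert j ({1..m} - {j}) = {1..m}" by auto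
  have "sum r {1..m} = r j + sum r ({1..m} - {j})"
    using j by (intro sum.remove) auto
  then have "total_length E l \<le> sum r ({1..m} - {j}) + 2 * r j"
    using assms(4) j by simp
  from rooted_tree_cover[OF _ A(1) _ _ this, unfolded I]
  obtain c where c: "\<forall>i\<in>{1..m}. c i \<in> tree_points V E" "A \<subseteq> (\<Union>i\<in>{1..m}. mcball (c i) (r i))"
    using assms(3) by auto
  have "mcball (c i) (r i) \<subseteq> tree_ball V E l (c i) (r i)" for i
    by (auto simp: tree_ball_def tree_dist_commute)
  then have "tree_points V E \<subseteq> (\<Union>i\<in>{1..m}. tree_ball V E l (c i) (r i))"
    using A(2) c(2) by blast
  then show ?thesis using c(1) unfolding is_cover_def by blast
qed

end
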